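(* Let $G=(V,E)$ be an infinite, connected graph with countable vertex set. Assume that $\partial_V^{n+1}\ge\partial_V^n\ge\partial_V^1\ge 2$ for all $n\ge 1$ and that all vertices have uniformly bounded degree, $\deg(v)\le D$. Suppose that $v_1,v_2,\dots$ is an enumeration of the vertices with the property that, for some constant $c>0$ and all $n\ge 1$, $$\partial_V(\{v_1,\dots,v_n\})\subseteq\{v_{n+1},\dots,v_{n+c\cdot\partial_V^n}\}.$$ Then, for the rearrangement $f\mapsto f^*$ defined by this enumeration, all functions $f:V\to\mathbb{R}$ vanishing at infinity and all $1\le p\le\infty$, $$\|\nabla f^*\|_{L^p}\;\le\;(c+1)\cdot D^{1/p}\cdot\|\nabla f\|_{L^p}.$$
   Context: Graphs are simple and undirected; $x\sim y$ means $(x,y)\in E$. For a finite $X\subset V$, $\partial_V(X):=\{z\in V\setminus X: z\sim x\text{ for some }x\in X\}$, and $\partial_V^n:=\min_{X\subset V,\,|X|=n}|\partial_V(X)|$. The set $\{v_{n+1},\dots,v_{n+c\cdot\partial_V^n}\}$ means $\{v_j: n<j\le n+c\,\partial_V^n\}$. For $g:V\to\mathbb{R}$, $\|\nabla g\|_{L^p}^p:=\sum_{x\sim y}|g(x)-g(y)|^p\in[0,\infty]$ (sum over edges) for $p<\infty$, and $\|\nabla g\|_{L^\infty}:=\sup_{x\sim y}|g(x)-g(y)|$; $D^{1/\infty}=1$. A function $f:V\to\mathbb{R}$ vanishes at infinity if $\{x:|f(x)|>t\}$ is finite for every $t>0$. The rearrangement of $f$ defined by the enumeration is $f^*(v_k):=$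 the $k$-th largest value of $|f|$ counted with multiplicity; precisely $f^*(v_k)=\sup\{t>0:|\{x:|f(x)|>t\}|\ge k\}$, with $\sup\emptyset=0$. *)

theory Defs
  imports "HOL-Analysis.Analysis"
begin

definition simple_graph :: "'a set \<Rightarrow> 'a set set \<Rightarrow> bool" where
  "simple_graph V E \<longleftrightarrow> (\<forall>e\<in>E. e \<subseteq> V \<and> card e = 2)"

definition connected_graph :: "'a set \<Rightarrow> 'a set set \<Rightarrow> bool" where
  "connected_graph V E \<longleftrightarrow> (\<forall>x\<in>V. \<forall>y\<in>V. (x, y) \<in> {(a, b). {a, b} \<in> E}\<^sup>*)"

definition neighbours :: "'a set set \<Rightarrow> 'a \<Rightarrow> 'a set" where
  "neighbours E x = {y. {x, y} \<in> E}"

(* Finiteness of the neighbourhood is stated explicitly because card is 0 on infinite sets. *)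
definition degree_le :: "'a set \<Rightarrow> 'a set set \<Rightarrow> real \<Rightarrow> bool" where
  "degree_le V E D \<longleftrightarrow>
    (\<forall>x\<in>V. finite (neighbours E x) \<and> real (card (neighbours E x)) \<le> D)"

definition vertex_boundary :: "'a set \<Rightarrow> 'a set set \<Rightarrow> 'a set \<Rightarrow> 'a set" where
  "vertex_boundary V E X = {z \<in> V - X. \<exists>x\<in>X. {x, z} \<in> E}"

(* For infinite V the index set is nonempty, so the infimum of natural numbers is attained.
   The cardinalities are the intended ones when all degrees are finite. *)
definition min_boundary :: "'a set \<Rightarrow> 'a set set \<Rightarrow> nat \<Rightarrow> nat" where
  "min_boundary V E n =
    (INF X \<in> {X. X \<subseteq> V \<and> finite X \<and> card X = n}. card (vertex_boundary V E X))"

definition vanishes_at_infinity :: "'a set \<Rightarrow> ('a \<Rightarrow> real) \<Rightarrow> bool" where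
  "vanishes_at_infinity V f \<longleftrightarrow> (\<forall>t>0. finite {x\<in>V. \<bar>f x\<bar> > t})"

(* The case distinction implements sup {} = 0; for f vanishing at infinity all the cardinalities
   are those of finite sets and, for k >= 1, the set of levels is bounded above. *)
definition kth_largest :: "'a set \<Rightarrow> ('a \<Rightarrow> real) \<Rightarrow> nat \<Rightarrow> real" where
  "kth_largest V f k =
    (let L = {t. t > 0 \<and> card {x\<in>V. \<bar>f x\<bar> > t} \<ge> k} in if L = {} then 0 else Sup L)"

(* The enumeration is v 1, v 2, ...; the value v 0 is not used. *)
definition rearrangement :: "'a set \<Rightarrow> (nat \<Rightarrow> 'a) \<Rightarrow> ('a \<Rightarrow> real) \<Rightarrow> 'a \<Rightarrow> real" where
  "rearrangement V v f x = kth_largest V f (the_inv_into {1..} v x)"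

lemma rearrangement_enum:
  assumes "bij_betw v {1..} V" and "k \<ge> 1"
  shows "rearrangement V v f (v k) = kth_largest V f k"
  using assms by (simp add: rearrangement_def bij_betw_def the_inv_into_f_f)

definition edge_diff :: "('a \<Rightarrow> real) \<Rightarrow> 'a set \<Rightarrow> real" where
  "edge_diff g e = (THE d. \<exists>x y. e = {x, y} \<and> d = \<bar>g x - g y\<bar>)"

lemma edge_diff_pair: "edge_diff g {x, y} = \<bar>g x - g y\<bar>"
  unfolding edge_diff_def by (rule the_equality) (auto simp: doubleton_eq_iff)

(* The L^p norm of the gradient, with values in [0,\<infinity>]; a divergent sum has p-th root \<infinity>. *)
definition grad_norm :: "'a set set \<Rightarrow> ennreal \<Rightarrow> ('a \<Rightarrow> real) \<Rightarrow> ennreal" where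
  "grad_norm E p g =
    (if p = \<infinity> then (SUP e\<in>E. ennreal (edge_diff g e))
     else let S = (\<Sum>\<^sub>\<infinity>e\<in>E. ennreal (edge_diff g e powr enn2real p))
          in if S = \<infinity> then \<infinity> else ennreal (enn2real S powr (1 / enn2real p)))"

end

theory Submission
  imports Defs
begin

text \<open>
  Write \<open>a n\<close> for the \<open>n\<close>-th largest value of \<open>\<bar>f\<bar>\<close>, \<open>b n\<close> for the minimal boundary size, and
  \<open>d n = a n - a (n + b n)\<close>. For \<open>t > 0\<close> and \<open>s \<ge> 0\<close> let \<open>N \<le> M\<close> be the sizes of the level sets
  \<open>{\<bar>f\<bar> > t + s}\<close> and \<open>{\<bar>f\<bar> > t}\<close>. The smaller one has at least \<open>b N\<close> boundary vertices, of which
  at most \<open>M - N\<close> lie in the larger one, so at least \<open>N + b N - M\<close> edges jump from above \<open>t + s\<close>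
  to at most \<open>t\<close>; since \<open>b\<close> is nondecreasing, at most that many \<open>n\<close> satisfy \<open>a n > t + s\<close> and
  \<open>a (n + b n) < t\<close>. Integrating over \<open>t\<close> compares the sums of the positive parts of \<open>d n - s\<close>
  and of \<open>\<bar>f x - f y\<bar> - s\<close> over the edges. Integrating this against \<open>p (p - 1) s powr (p - 2)\<close>
  bounds the \<open>p\<close>-th power sum of \<open>d\<close> by that of the gradient of \<open>f\<close>.

  An edge between \<open>v i\<close> and \<open>v j\<close> with \<open>i < j\<close> has \<open>j \<le> i + K * b i\<close> for \<open>K = \<lceil>c\<rceil>\<close>, so the
  rearrangement changes along it by at most the sum of \<open>d (i + k * b i)\<close> over \<open>k < K\<close>. The maps
  \<open>i \<mapsto> i + k * b i\<close> are injective and each \<open>i\<close> is the lower endpoint of at most \<open>D\<close> edges, which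
  costs the factors \<open>K powr p\<close> and \<open>D\<close>.
\<close>

section \<open>Edges, and sums as integrals over counting measures\<close>

lemma edge_diff_nonneg:
  assumes "simple_graph V E" and "e \<in> E"
  shows "edge_diff g e \<ge> 0"
proof -
  obtain x y where "e = {x, y}"
    using assms unfolding simple_graph_def by (auto simp: card_2_iff)
  then show ?thesis by (simp add: edge_diff_pair)
qed

lemma countable_edges:
  assumes "simple_graph V E" and "countable V"
  shows "countable E"
proof (rule countable_subset)
  show "E \<subseteq> {F. finite F \<and> F \<subseteq> V}"
    using assms(1) unfolding simple_graph_def by (auto intro: card_ge_0_finite)
  show "countable {F. finite F \<and> F \<subseteq> V}"
    using assms(2) by (rule countable_Collect_finite_subset)
qed

text \<open>\<open>grad_norm\<close> is defined through \<open>infsum\<close>, whereas Tonelli and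
  monotone comparison are applied to integrals over \<open>count_space\<close>. Both are suprema of
  finite partial sums.\<close>

lemma nn_integral_count_space_eq_infsum:
  fixes g :: "'b \<Rightarrow> ennreal"
  assumes "countable A"
  shows "(\<integral>\<^sup>+x. g x \<partial>count_space A) = (\<Sum>\<^sub>\<infinity>x\<in>A. g x)"
proof -
  have sup: "(\<Sum>\<^sub>\<infinity>x\<in>A. g x) = (SUP F\<in>{F. finite F \<and> F \<subseteq> A}. sum g F)"
    by (rule nonneg_infsum_complete) simp
  show ?thesis
  proof (cases "finite A")
    case True
    then show ?thesis by (simp add: nn_integral_count_space_finite)
  next
    case False
    define h where "h = from_nat_into A"
    have h: "bij_betw h UNIV A"
      unfolding h_def using assms False by (rule bij_betw_from_nat_into)
    show ?thesis
    proof (rule antisym)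
      have "(\<integral>\<^sup>+x. g x \<partial>count_space A) = (\<Sum>i. g (h i))"
        by (simp add: nn_integral_bij_count_space[OF h, symmetric] nn_integral_count_space_nat)
      also have "\<dots> = (SUP n. \<Sum>i<n. g (h i))"
        by (rule suminf_eq_SUP)
      also have "\<dots> \<le> (\<Sum>\<^sub>\<infinity>x\<in>A. g x)"
      proof (rule SUP_least)
        fix n :: nat
        have "(\<Sum>i<n. g (h i)) = sum g (h ` {..<n})"
          using h by (subst sum.reindex) (auto simp: bij_betw_def intro: inj_on_subset)
        also have "\<dots> \<le> (\<Sum>\<^sub>\<infinity>x\<in>A. g x)"
          unfolding sup using h by (intro SUP_upper) (auto simp: bij_betw_def)
        finally show "(\<Sum>i<n. g (h i)) \<le> (\<Sum>\<^sub>\<infinity>x\<in>A. g x)" .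
      qed
      finally show "(\<integral>\<^sup>+x. g x \<partial>count_space A) \<le> (\<Sum>\<^sub>\<infinity>x\<in>A. g x)" .
      show "(\<Sum>\<^sub>\<infinity>x\<in>A. g x) \<le> (\<integral>\<^sup>+x. g x \<partial>count_space A)"
        unfolding sup
      proof (rule SUP_least)
        fix F assume F: "F \<in> {F. finite F \<and> F \<subseteq> A}"
        then have "sum g F = (\<integral>\<^sup>+x. g x * indicator F x \<partial>count_space A)"
          by (subst nn_integral_count_space'[of F]) (auto intro!: sum.cong)
        also have "\<dots> \<le> (\<integral>\<^sup>+x. g x \<partial>count_space A)"
          by (intro nn_integral_mono) (auto simp: indicator_def)
        finally show "sum g F \<le> (\<integral>\<^sup>+x. g x \<partial>count_space A)" .
      qed
    qed
  qed
qed

section \<open>Power sums as weighted integrals of truncated sums, and the power mean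
  inequality\<close>

text \<open>Taylor's formula at 0 with integral remainder: the weight is the second derivative of
  \<open>s powr p\<close>. As \<open>ennreal\<close> sends negative reals to 0,
  \<open>ennreal (x - s)\<close> is a positive part.\<close>

lemma powr_eq_nn_integral_truncation:
  fixes x p :: real
  assumes "p > 1" and "x \<ge> 0"
  shows "ennreal (x powr p)
    = (\<integral>\<^sup>+s. ennreal (p * (p - 1) * s powr (p - 2)) * indicator {0..} s * ennreal (x - s) \<partial>lborel)"
proof -
  let ?w = "\<lambda>s. p * (p - 1) * (x * s powr (p - 2) - s powr (p - 1))"
  \<comment> \<open>Both exponents exceed -1, so integration from 0 is legitimate even for
    \<open>p < 2\<close>, where \<open>s powr (p - 2)\<close> is unbounded near 0.\<close>
  have "((\<lambda>s. s powr (p - 2)) has_integral (x powr (p - 2 + 1) / (p - 2 + 1))) {0..x}"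
    and "((\<lambda>s. s powr (p - 1)) has_integral (x powr (p - 1 + 1) / (p - 1 + 1))) {0..x}"
    using assms by (intro has_integral_powr_from_0; simp)+
  then have "(?w has_integral (p * (p - 1) *
      (x * (x powr (p - 2 + 1) / (p - 2 + 1)) - x powr (p - 1 + 1) / (p - 1 + 1)))) {0..x}"
    by (intro has_integral_mult_right has_integral_diff)
  moreover have "p * (p - 1) *
      (x * (x powr (p - 2 + 1) / (p - 2 + 1)) - x powr (p - 1 + 1) / (p - 1 + 1)) = x powr p"
  proof -
    have "x * x powr (p - 1) = x powr p"
      using assms by (cases "x = 0") (simp_all add: powr_mult_base)
    then show ?thesis using assms by (simp add: field_simps)
  qed
  ultimately have int: "(?w has_integral (x powr p)) {0..x}" by simp
  have w: "?w s = p * (p - 1) * s powr (p - 2) * (x - s)" if "s \<ge> 0" for s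
  proof -
    have "s * s powr (p - 2) = s powr (p - 1)"
      using that assms by (cases "s = 0") (simp_all add: powr_mult_base)
    then show ?thesis by (simp add: algebra_simps)
  qed
  have "(\<integral>\<^sup>+s. ennreal (?w s) * indicator {0..x} s \<partial>lborel) = ennreal (x powr p)"
    using w assms int by (intro nn_integral_has_integral_lebesgue') auto
  also have "(\<integral>\<^sup>+s. ennreal (?w s) * indicator {0..x} s \<partial>lborel) =
    (\<integral>\<^sup>+s. ennreal (p * (p - 1) * s powr (p - 2)) * indicator {0..} s * ennreal (x - s) \<partial>lborel)"
  proof (intro nn_integral_cong)
    fix s :: real
    show "ennreal (?w s) * indicator {0..x} s
        = ennreal (p * (p - 1) * s powr (p - 2)) * indicator {0..} s * ennreal (x - s)"
    proof (cases "s \<in> {0..x}")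
      case True
      then show ?thesis using assms w[of s] by (simp add: ennreal_mult mult.assoc)
    next
      case False
      then show ?thesis by (auto simp: indicator_def ennreal_neg)
    qed
  qed
  finally show ?thesis ..
qed

lemma nn_integral_powr_eq_truncations:
  fixes z :: "'i \<Rightarrow> real"
  assumes "p > 1" and "countable I" and "\<And>i. i \<in> I \<Longrightarrow> z i \<ge> 0"
  shows "(\<integral>\<^sup>+i. ennreal (z i powr p) \<partial>count_space I)
    = (\<integral>\<^sup>+s. ennreal (p * (p - 1) * s powr (p - 2)) * indicator {0..} s
        * (\<integral>\<^sup>+i. ennreal (z i - s) \<partial>count_space I) \<partial>lborel)"
proof -
  let ?w = "\<lambda>s. ennreal (p * (p - 1) * s powr (p - 2)) * indicator {0..} s"
  have "(\<integral>\<^sup>+i. ennreal (z i powr p) \<partial>count_space I)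
      = (\<integral>\<^sup>+i. (\<integral>\<^sup>+s. ?w s * ennreal (z i - s) \<partial>lborel) \<partial>count_space I)"
    using assms by (intro nn_integral_cong powr_eq_nn_integral_truncation) simp_all
  also have "\<dots> = (\<integral>\<^sup>+s. (\<integral>\<^sup>+i. ?w s * ennreal (z i - s) \<partial>count_space I) \<partial>lborel)"
    using assms by (intro nn_integral_count_space_nn_integral[symmetric]) auto
  also have "\<dots> = (\<integral>\<^sup>+s. ?w s * (\<integral>\<^sup>+i. ennreal (z i - s) \<partial>count_space I) \<partial>lborel)"
    by (intro nn_integral_cong nn_integral_cmult) simp
  finally show ?thesis .
qed

text \<open>Each power sum is an integral over \<open>s\<close> of truncated sums against a
  nonnegative weight, so a comparison at every \<open>s\<close> carries over. The weight vanishes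
  identically for \<open>p = 1\<close>; there the truncation at \<open>s = 0\<close> is already the
  claim.\<close>

lemma nn_integral_powr_le_if_truncations_le:
  fixes x :: "'i \<Rightarrow> real" and y :: "'j \<Rightarrow> real"
  assumes "countable I" and "countable J"
    and x: "\<And>i. i \<in> I \<Longrightarrow> x i \<ge> 0" and y: "\<And>j. j \<in> J \<Longrightarrow> y j \<ge> 0" and "p \<ge> 1"
    and le: "\<And>s. s \<ge> 0 \<Longrightarrow> (\<integral>\<^sup>+i. ennreal (x i - s) \<partial>count_space I)
               \<le> (\<integral>\<^sup>+j. ennreal (y j - s) \<partial>count_space J)"
  shows "(\<integral>\<^sup>+i. ennreal (x i powr p) \<partial>count_space I) \<le> (\<integral>\<^sup>+j. ennreal (y j powr p) \<partial>count_space J)"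
proof (cases "p = 1")
  case True
  with le[of 0] show ?thesis using x y by (simp cong: nn_integral_cong_simp)
next
  case False
  with \<open>p \<ge> 1\<close> have p: "p > 1" by simp
  let ?w = "\<lambda>s. ennreal (p * (p - 1) * s powr (p - 2)) * indicator {0..} s"
  have "(\<integral>\<^sup>+i. ennreal (x i powr p) \<partial>count_space I)
      = (\<integral>\<^sup>+s. ?w s * (\<integral>\<^sup>+i. ennreal (x i - s) \<partial>count_space I) \<partial>lborel)"
    using p \<open>countable I\<close> x by (rule nn_integral_powr_eq_truncations)
  also have "\<dots> \<le> (\<integral>\<^sup>+s. ?w s * (\<integral>\<^sup>+j. ennreal (y j - s) \<partial>count_space J) \<partial>lborel)"
    by (intro nn_integral_mono) (auto simp: indicator_def intro!: mult_left_mono le)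
  also have "\<dots> = (\<integral>\<^sup>+j. ennreal (y j powr p) \<partial>count_space J)"
    using p \<open>countable J\<close> y by (rule nn_integral_powr_eq_truncations[symmetric])
  finally show ?thesis .
qed

text \<open>Jensen's inequality for the convex function \<open>t powr p\<close>, applied to an
  average.\<close>

lemma sum_powr_le_power_mean:
  fixes x :: "'i \<Rightarrow> real"
  assumes "finite S" and nonneg: "\<And>i. i \<in> S \<Longrightarrow> x i \<ge> 0" and "p \<ge> 1"
  shows "(\<Sum>i\<in>S. x i) powr p \<le> real (card S) powr (p - 1) * (\<Sum>i\<in>S. x i powr p)"
proof -
  \<comment> \<open>\<open>powr_convex\<close> excludes \<open>0\<close>, so the zero terms are dropped first.\<close>
  define T where "T = {i\<in>S. x i > 0}"
  have T: "finite T" "T \<subseteq> S" using \<open>finite S\<close> by (auto simp: T_def)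
  have sums: "(\<Sum>i\<in>S. x i) = (\<Sum>i\<in>T. x i)" "(\<Sum>i\<in>S. x i powr p) = (\<Sum>i\<in>T. x i powr p)"
    using \<open>finite S\<close> nonneg by (auto simp: T_def less_le intro!: sum.mono_neutral_right)
  show ?thesis
  proof (cases "T = {}")
    case True
    then show ?thesis using sums by simp
  next
    case False
    define n where "n = real (card T)"
    have n: "n > 0" using False T by (simp add: n_def card_gt_0_iff)
    have "(\<Sum>i\<in>T. (1 / n) *\<^sub>R x i) powr p \<le> (\<Sum>i\<in>T. 1 / n * (x i powr p))"
      using T False n
      by (intro convex_on_sum[OF _ _ powr_convex[OF \<open>p \<ge> 1\<close>]]) (auto simp: T_def n_def)
    then have "((\<Sum>i\<in>T. x i) / n) powr p \<le> (\<Sum>i\<in>T. x i powr p) / n"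
      by (simp add: sum_divide_distrib)
    moreover have "(\<Sum>i\<in>T. x i) \<ge> 0" by (intro sum_nonneg) (auto simp: T_def)
    ultimately have "(\<Sum>i\<in>T. x i) powr p / n powr p \<le> (\<Sum>i\<in>T. x i powr p) / n"
      using n by (simp add: powr_divide)
    then have "(\<Sum>i\<in>T. x i) powr p \<le> n powr (p - 1) * (\<Sum>i\<in>T. x i powr p)"
      using n by (simp add: powr_diff field_simps)
    also have "\<dots> \<le> real (card S) powr (p - 1) * (\<Sum>i\<in>T. x i powr p)"
      using T \<open>finite S\<close> \<open>p \<ge> 1\<close> n unfolding n_def
      by (intro mult_right_mono powr_mono2 sum_nonneg) (auto intro: card_mono)
    finally show ?thesis using sums by simp
  qed
qed

section \<open>Order statistics of a function vanishing at infinity\<close>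

text \<open>Converts order statistics into sizes of level sets. The strict inequality comes from
  finiteness: the values above \<open>\<tau>\<close> have a minimum, and it is still above
  \<open>\<tau>\<close>.\<close>

lemma kth_largest_gt_iff:
  assumes "vanishes_at_infinity V f" and "k \<ge> 1" and "\<tau> > 0"
  shows "\<tau> < kth_largest V f k \<longleftrightarrow> k \<le> card {x\<in>V. \<bar>f x\<bar> > \<tau>}"
proof -
  define L where "L = {t. t > 0 \<and> card {x\<in>V. \<bar>f x\<bar> > t} \<ge> k}"
  have fin: "finite {x\<in>V. \<bar>f x\<bar> > t}" if "t > 0" for t
    using assms(1) that by (simp add: vanishes_at_infinity_def)
  \<comment> \<open>A level above 1 that is exceeded somewhere lies below one of the finitely many
    values above 1.\<close>
  have bdd: "bdd_above L"
  proof (rule bdd_aboveI)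
    fix t assume t: "t \<in> L"
    show "t \<le> Max (insert 1 ((\<lambda>x. \<bar>f x\<bar>) ` {x\<in>V. \<bar>f x\<bar> > 1}))"
    proof (cases "t \<le> 1")
      case True
      then show ?thesis using fin[of 1] by (intro order_trans[OF True] Max_ge) auto
    next
      case False
      from t \<open>k \<ge> 1\<close> have "{x\<in>V. \<bar>f x\<bar> > t} \<noteq> {}" by (auto simp: L_def simp del: Collect_empty_eq)
      then obtain x where "x \<in> V" "\<bar>f x\<bar> > t" by auto
      with False have "t \<le> \<bar>f x\<bar>" "x \<in> {x\<in>V. \<bar>f x\<bar> > 1}" by auto
      then show ?thesis using fin[of 1] by (intro order_trans[OF \<open>t \<le> \<bar>f x\<bar>\<close>] Max_ge) auto
    qed
  qed
  have kth: "kth_largest V f k = (if L = {} then 0 else Sup L)"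
    by (simp only: kth_largest_def L_def Let_def)
  show ?thesis
  proof
    assume "\<tau> < kth_largest V f k"
    then have "L \<noteq> {}" "\<tau> < Sup L" using kth \<open>\<tau> > 0\<close> by (auto split: if_splits)
    then obtain t where "t \<in> L" "\<tau> < t" using bdd by (auto simp: less_cSup_iff)
    then have "k \<le> card {x\<in>V. \<bar>f x\<bar> > t}" by (simp add: L_def)
    also have "\<dots> \<le> card {x\<in>V. \<bar>f x\<bar> > \<tau>}"
      using \<open>\<tau> < t\<close> \<open>\<tau> > 0\<close> by (intro card_mono fin) auto
    finally show "k \<le> card {x\<in>V. \<bar>f x\<bar> > \<tau>}" .
  next
    let ?A = "{x\<in>V. \<bar>f x\<bar> > \<tau>}"
    assume k: "k \<le> card ?A"
    then have "?A \<noteq> {}" using \<open>k \<ge> 1\<close> by (auto simp del: Collect_empty_eq)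
    define m where "m = Min ((\<lambda>x. \<bar>f x\<bar>) ` ?A)"
    have "m \<in> (\<lambda>x. \<bar>f x\<bar>) ` ?A"
      unfolding m_def using fin[OF \<open>\<tau> > 0\<close>] \<open>?A \<noteq> {}\<close> by (intro Min_in) auto
    then have "m > \<tau>" by auto
    \<comment> \<open>Every vertex above \<open>\<tau>\<close> is also above such a
      \<open>t\<close>, so \<open>t\<close> belongs to \<open>L\<close> and pushes the supremum
      strictly above \<open>\<tau>\<close>.\<close>
    then obtain t where t: "\<tau> < t" "t < m" using dense by blast
    have "?A \<subseteq> {x\<in>V. \<bar>f x\<bar> > t}"
    proof
      fix x assume "x \<in> ?A"
      then have "m \<le> \<bar>f x\<bar>" unfolding m_def using fin[OF \<open>\<tau> > 0\<close>] by (intro Min_le) auto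
      with t \<open>x \<in> ?A\<close> show "x \<in> {x\<in>V. \<bar>f x\<bar> > t}" by auto
    qed
    then have "card ?A \<le> card {x\<in>V. \<bar>f x\<bar> > t}"
      using t \<open>\<tau> > 0\<close> by (intro card_mono fin) auto
    then have "t \<in> L" using k t \<open>\<tau> > 0\<close> by (auto simp: L_def)
    then have "t \<le> Sup L" "L \<noteq> {}" using bdd by (auto intro: cSup_upper)
    then show "\<tau> < kth_largest V f k" using kth t by simp
  qed
qed

lemma kth_largest_nonneg:
  assumes "vanishes_at_infinity V f" and "k \<ge> 1"
  shows "kth_largest V f k \<ge> 0"
proof (cases "{t. t > 0 \<and> card {x\<in>V. \<bar>f x\<bar> > t} \<ge> k} = {}")
  case True
  then show ?thesis by (simp add: kth_largest_def del: Collect_empty_eq)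
next
  case False
  then obtain t where t: "t > 0" "card {x\<in>V. \<bar>f x\<bar> > t} \<ge> k" by auto
  have "card {x\<in>V. \<bar>f x\<bar> > t} \<le> card {x\<in>V. \<bar>f x\<bar> > t / 2}"
  proof (rule card_mono)
    show "finite {x\<in>V. \<bar>f x\<bar> > t / 2}"
      using assms(1) t(1) unfolding vanishes_at_infinity_def by (meson half_gt_zero)
  qed (use t(1) in auto)
  with t show ?thesis
    using kth_largest_gt_iff[OF assms, of "t / 2"] by linarith
qed

lemma kth_largest_antimono:
  assumes "vanishes_at_infinity V f" and "1 \<le> k" and "k \<le> m"
  shows "kth_largest V f m \<le> kth_largest V f k"
proof (rule ccontr)
  assume "\<not> ?thesis"
  then obtain \<tau> where \<tau>: "kth_largest V f k < \<tau>" "\<tau> < kth_largest V f m"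
    using dense by (metis not_le)
  moreover then have "\<tau> > 0" using kth_largest_nonneg[OF assms(1,2)] by simp
  ultimately show False
    using assms kth_largest_gt_iff[of V f m \<tau>] kth_largest_gt_iff[of V f k \<tau>] by auto
qed

section \<open>Vertex boundaries of finite sets\<close>

lemma finite_vertex_boundary:
  assumes "degree_le V E D" and "finite X" and "X \<subseteq> V"
  shows "finite (vertex_boundary V E X)"
proof (rule finite_subset)
  show "vertex_boundary V E X \<subseteq> (\<Union>x\<in>X. neighbours E x)"
    by (auto simp: vertex_boundary_def neighbours_def)
  show "finite (\<Union>x\<in>X. neighbours E x)"
    using assms by (auto simp: degree_le_def)
qed

lemma min_boundary_le:
  assumes "finite X" and "X \<subseteq> V"
  shows "min_boundary V E (card X) \<le> card (vertex_boundary V E X)"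
  unfolding min_boundary_def using assms by (intro cINF_lower) auto

lemma min_boundary_mono:
  assumes step: "\<And>n. n \<ge> 1 \<Longrightarrow> min_boundary V E n \<le> min_boundary V E (n + 1)"
    and "1 \<le> m" and "m \<le> n"
  shows "min_boundary V E m \<le> min_boundary V E n"
  using \<open>m \<le> n\<close>
proof (induction n rule: dec_induct)
  case (step k)
  then show ?case using assms(1)[of k] \<open>1 \<le> m\<close> by simp
qed simp

section \<open>Comparison of the gaps of the order statistics with the gradient of
  \<open>f\<close>\<close>

text \<open>\<open>Min\<close> and \<open>Max\<close> are the smaller and the larger value of
  \<open>\<bar>f\<bar>\<close> at the ends of an edge. The gaps straddling the level are matched
  with boundary vertices of \<open>B\<close> outside \<open>A\<close>, and each such vertex supplies
  its own edge.\<close>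

lemma count_gaps_le_count_edges:
  fixes V :: "'a set" and E :: "'a set set" and f :: "'a \<Rightarrow> real" and s t :: real
  defines "a \<equiv> kth_largest V f" and "b \<equiv> min_boundary V E"
  assumes "degree_le V E D" and van: "vanishes_at_infinity V f"
    and mono: "\<And>n. n \<ge> 1 \<Longrightarrow> min_boundary V E n \<le> min_boundary V E (n + 1)"
    and "t > 0" and "s \<ge> 0"
  shows "emeasure (count_space {1..}) {n \<in> {1..}. a (n + b n) < t \<and> t < a n - s}
    \<le> emeasure (count_space E)
        {e \<in> E. Min ((\<lambda>x. \<bar>f x\<bar>) ` e) \<le> t \<and> t < Max ((\<lambda>x. \<bar>f x\<bar>) ` e) - s}"
    (is "_ {n \<in> _. ?P n} \<le> emeasure _ ?Q")
proof -
  define A where "A = {x\<in>V. \<bar>f x\<bar> > t}"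
  define B where "B = {x\<in>V. \<bar>f x\<bar> > t + s}"
  define N where "N = card B"
  define M where "M = card A"
  have fin: "finite A" "finite B"
    using van \<open>t > 0\<close> \<open>s \<ge> 0\<close> by (simp_all add: A_def B_def vanishes_at_infinity_def)
  have "B \<subseteq> A" "A \<subseteq> V" "B \<subseteq> V" using \<open>s \<ge> 0\<close> by (auto simp: A_def B_def)
  then have "N \<le> M" using fin by (auto simp: N_def M_def intro: card_mono)
  define Z where "Z = vertex_boundary V E B - A"
  have finB: "finite (vertex_boundary V E B)"
    using assms(3) fin \<open>B \<subseteq> V\<close> by (intro finite_vertex_boundary) auto
  \<comment> \<open>The boundary vertices of \<open>B\<close> lie in \<open>Z\<close> or in
    \<open>A - B\<close>, and the latter set has only \<open>M - N\<close> elements.\<close>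
  have "b N \<le> card (vertex_boundary V E B)"
    using fin \<open>B \<subseteq> V\<close> unfolding N_def b_def by (intro min_boundary_le)
  also have "\<dots> \<le> card (Z \<union> (A - B))"
    using finB fin by (intro card_mono) (auto simp: Z_def vertex_boundary_def)
  also have "\<dots> \<le> card Z + card (A - B)" by (rule card_Un_le)
  also have "card (A - B) = M - N"
    using fin \<open>B \<subseteq> A\<close> by (simp add: card_Diff_subset N_def M_def)
  finally have Z: "b N \<le> card Z + (M - N)" .
  \<comment> \<open>A counted \<open>n\<close> satisfies \<open>n \<le> N\<close> and
    \<open>M < n + b n \<le> n + b N\<close>. If \<open>b N > M\<close>, the truncated difference is
    0, which still fits because \<open>n \<ge> 1\<close>.\<close>
  have sub: "{n \<in> {1..}. ?P n} \<subseteq> {M - b N<..N}"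
  proof
    fix n assume "n \<in> {n \<in> {1..}. ?P n}"
    then have n: "n \<ge> 1" "a (n + b n) < t" "t + s < a n" by auto
    have "n \<le> N"
      using kth_largest_gt_iff[OF van n(1), of "t + s"] n(3) \<open>t > 0\<close> \<open>s \<ge> 0\<close>
      by (simp add: a_def N_def B_def)
    moreover have "M < n + b n"
      using kth_largest_gt_iff[OF van, of "n + b n" t] n(1,2) \<open>t > 0\<close>
      by (simp add: a_def M_def A_def)
    moreover have "b n \<le> b N"
      unfolding b_def using mono n(1) \<open>n \<le> N\<close> by (rule min_boundary_mono)
    ultimately show "n \<in> {M - b N<..N}" using n(1) by auto
  qed
  have "card {n \<in> {1..}. ?P n} \<le> card {M - b N<..N}"
    using sub by (intro card_mono) auto
  also have "\<dots> \<le> card Z" using Z \<open>N \<le> M\<close> by simp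
  finally have card: "card {n \<in> {1..}. ?P n} \<le> card Z" .
  have "\<forall>z\<in>Z. \<exists>u\<in>B. {u, z} \<in> E" by (auto simp: Z_def vertex_boundary_def)
  then obtain u where u: "\<And>z. z \<in> Z \<Longrightarrow> u z \<in> B \<and> {u z, z} \<in> E" by metis
  \<comment> \<open>One end of each chosen edge lies in \<open>A\<close> and the other outside, so
    the edge determines \<open>z\<close>.\<close>
  have inj: "inj_on (\<lambda>z. {u z, z}) Z"
  proof (rule inj_onI)
    fix z z' assume "z \<in> Z" "z' \<in> Z" "{u z, z} = {u z', z'}"
    moreover then have "u z \<in> A" "z' \<notin> A" using u \<open>B \<subseteq> A\<close> by (auto simp: Z_def)
    ultimately show "z = z'" by (auto simp: doubleton_eq_iff)
  qed
  have img: "(\<lambda>z. {u z, z}) ` Z \<subseteq> ?Q"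
  proof
    fix e assume "e \<in> (\<lambda>z. {u z, z}) ` Z"
    then obtain z where z: "z \<in> Z" and e: "e = {u z, z}" by auto
    then have "\<bar>f (u z)\<bar> > t + s" "\<bar>f z\<bar> \<le> t" "e \<in> E"
      using u[OF z] by (auto simp: Z_def A_def B_def vertex_boundary_def)
    then show "e \<in> ?Q" unfolding e by (auto simp: min_le_iff_disj less_diff_eq less_max_iff_disj)
  qed
  have "finite Z" using finB by (simp add: Z_def)
  have "emeasure (count_space {1..}) {n \<in> {1..}. ?P n} = of_nat (card {n \<in> {1..}. ?P n})"
    using finite_subset[OF sub] by (subst emeasure_count_space_finite) auto
  also have "\<dots> \<le> of_nat (card Z)" using card by simp
  also have "\<dots> = of_nat (card ((\<lambda>z. {u z, z}) ` Z))" using inj by (simp add: card_image)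
  also have "\<dots> = emeasure (count_space E) ((\<lambda>z. {u z, z}) ` Z)"
    using \<open>finite Z\<close> img by (subst emeasure_count_space_finite) auto
  also have "\<dots> \<le> emeasure (count_space E) ?Q"
    using img by (intro emeasure_mono) auto
  finally show ?thesis .
qed

text \<open>The counting inequality is integrated over \<open>t\<close>; by Tonelli each gap and
  each edge contributes the length of its interval of levels.\<close>

lemma nn_integral_gap_truncation_le:
  fixes V :: "'a set" and E :: "'a set set" and f :: "'a \<Rightarrow> real" and s :: real
  defines "a \<equiv> kth_largest V f" and "b \<equiv> min_boundary V E"
  assumes simple: "simple_graph V E" and "countable V"
    and deg: "degree_le V E D" and van: "vanishes_at_infinity V f"
    and mono: "\<And>n. n \<ge> 1 \<Longrightarrow> min_boundary V E n \<le> min_boundary V E (n + 1)"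
    and "s \<ge> 0"
  shows "(\<integral>\<^sup>+n. ennreal (a n - a (n + b n) - s) \<partial>count_space {1..})
    \<le> (\<integral>\<^sup>+e. ennreal (edge_diff f e - s) \<partial>count_space E)"
proof -
  define lo where "lo e = Min ((\<lambda>x. \<bar>f x\<bar>) ` e)" for e
  define hi where "hi e = Max ((\<lambda>x. \<bar>f x\<bar>) ` e)" for e
  have "countable E" using simple \<open>countable V\<close> by (rule countable_edges)
  \<comment> \<open>Gaps are counted with open intervals of levels and edges with half-open ones.
    The lengths agree, and \<open>ennreal\<close> gives 0 when the endpoints are in the wrong
    order.\<close>
  have Ioo: "ennreal (y - x) = (\<integral>\<^sup>+t. indicator {x<..<y} t \<partial>lborel)" for x y :: real
    by (cases "x \<le> y") (simp_all add: ennreal_neg)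
  have Ico: "ennreal (y - x) = (\<integral>\<^sup>+t. indicator {x..<y} t \<partial>lborel)" for x y :: real
    by (cases "x \<le> y") (simp_all add: ennreal_neg)
  have "(\<integral>\<^sup>+n. ennreal (a n - a (n + b n) - s) \<partial>count_space {1..})
      = (\<integral>\<^sup>+n. (\<integral>\<^sup>+t. indicator {a (n + b n)<..<a n - s} t \<partial>lborel) \<partial>count_space {1..})"
    unfolding Ioo[symmetric] by (intro nn_integral_cong) (simp add: algebra_simps)
  also have "\<dots> = (\<integral>\<^sup>+t. (\<integral>\<^sup>+n. indicator {a (n + b n)<..<a n - s} t \<partial>count_space {1..}) \<partial>lborel)"
    by (intro nn_integral_count_space_nn_integral[symmetric]) auto
  also have "\<dots> \<le> (\<integral>\<^sup>+t. (\<integral>\<^sup>+e. indicator {lo e..<hi e - s} t \<partial>count_space E) \<partial>lborel)"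
  proof (rule nn_integral_mono)
    fix t :: real
    have "(\<integral>\<^sup>+n. indicator {a (n + b n)<..<a n - s} t \<partial>count_space {1..})
        = (\<integral>\<^sup>+n. indicator {n \<in> {1..}. a (n + b n) < t \<and> t < a n - s} n \<partial>count_space {1..})"
      by (intro nn_integral_cong) (auto simp: indicator_def)
    also have "\<dots> = emeasure (count_space {1..}) {n \<in> {1..}. a (n + b n) < t \<and> t < a n - s}"
      by (rule nn_integral_indicator) auto
    also have "\<dots> \<le> emeasure (count_space E) {e \<in> E. lo e \<le> t \<and> t < hi e - s}"
    proof (cases "t > 0")
      case True
      then show ?thesis
        unfolding a_def b_def lo_def hi_def
        using deg van mono \<open>s \<ge> 0\<close> by (intro count_gaps_le_count_edges)
    next
      \<comment> \<open>At a nonpositive level no gap is counted, since the values of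
        \<open>a\<close> are nonnegative.\<close>
      case False
      then have "\<not> a (n + b n) < t" if "n \<in> {1..}" for n
        using that kth_largest_nonneg[OF van, of "n + b n"] by (auto simp: a_def)
      then have "{n \<in> {1..}. a (n + b n) < t \<and> t < a n - s} = {}" by blast
      then show ?thesis by (simp del: Collect_empty_eq)
    qed
    also have "\<dots> = (\<integral>\<^sup>+e. indicator {e \<in> E. lo e \<le> t \<and> t < hi e - s} e \<partial>count_space E)"
      by (rule nn_integral_indicator[symmetric]) auto
    also have "\<dots> = (\<integral>\<^sup>+e. indicator {lo e..<hi e - s} t \<partial>count_space E)"
      by (intro nn_integral_cong) (auto simp: indicator_def)
    finally show "(\<integral>\<^sup>+n. indicator {a (n + b n)<..<a n - s} t \<partial>count_space {1..})
      \<le> (\<integral>\<^sup>+e. indicator {lo e..<hi e - s} t \<partial>count_space E)" .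
  qed
  also have "\<dots> = (\<integral>\<^sup>+e. (\<integral>\<^sup>+t. indicator {lo e..<hi e - s} t \<partial>lborel) \<partial>count_space E)"
    using \<open>countable E\<close> by (intro nn_integral_count_space_nn_integral) auto
  also have "\<dots> \<le> (\<integral>\<^sup>+e. ennreal (edge_diff f e - s) \<partial>count_space E)"
    unfolding Ico[symmetric]
  proof (intro nn_integral_mono ennreal_leI)
    fix e assume "e \<in> space (count_space E)"
    then obtain x y where "e = {x, y}"
      using simple unfolding simple_graph_def by (auto simp: card_2_iff)
    \<comment> \<open>This is the reverse triangle inequality for \<open>\<bar>f x\<bar>\<close> and
      \<open>\<bar>f y\<bar>\<close>.\<close>
    then show "hi e - s - lo e \<le> edge_diff f e - s"
      by (auto simp: hi_def lo_def edge_diff_pair)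
  qed
  finally show ?thesis .
qed

lemma nn_integral_gap_powr_le:
  fixes V :: "'a set" and E :: "'a set set" and f :: "'a \<Rightarrow> real" and p :: real
  defines "a \<equiv> kth_largest V f" and "b \<equiv> min_boundary V E"
  assumes simple: "simple_graph V E" and "countable V"
    and deg: "degree_le V E D" and van: "vanishes_at_infinity V f"
    and mono: "\<And>n. n \<ge> 1 \<Longrightarrow> min_boundary V E n \<le> min_boundary V E (n + 1)"
    and "p \<ge> 1"
  shows "(\<integral>\<^sup>+n. ennreal ((a n - a (n + b n)) powr p) \<partial>count_space {1..})
    \<le> (\<integral>\<^sup>+e. ennreal (edge_diff f e powr p) \<partial>count_space E)"
proof (rule nn_integral_powr_le_if_truncations_le)
  show "countable E" using simple \<open>countable V\<close> by (rule countable_edges)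
  show "(\<integral>\<^sup>+n. ennreal (a n - a (n + b n) - s) \<partial>count_space {1..})
    \<le> (\<integral>\<^sup>+e. ennreal (edge_diff f e - s) \<partial>count_space E)" if "s \<ge> 0" for s
    unfolding a_def b_def using assms(3-7) that by (intro nn_integral_gap_truncation_le)
  show "0 \<le> a n - a (n + b n)" if "n \<in> {1..}" for n
    using kth_largest_antimono[OF van, of n "n + b n"] that by (simp add: a_def)
  show "0 \<le> edge_diff f e" if "e \<in> E" for e
    using simple that by (rule edge_diff_nonneg)
qed (use \<open>p \<ge> 1\<close> in auto)

text \<open>Counterpart for \<open>p = \<infinity>\<close>: truncating at the supremum
  \<open>G\<close> of the edge differences annihilates the sum over edges, hence every term of the
  sum over gaps.\<close>

lemma gap_le_SUP_edge_diff:
  fixes V :: "'a set" and E :: "'a set set" and f :: "'a \<Rightarrow> real"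
  defines "a \<equiv> kth_largest V f" and "b \<equiv> min_boundary V E"
  assumes "simple_graph V E" and "countable V"
    and "degree_le V E D" and "vanishes_at_infinity V f"
    and "\<And>n. n \<ge> 1 \<Longrightarrow> min_boundary V E n \<le> min_boundary V E (n + 1)"
    and "n \<ge> 1"
  shows "ennreal (a n - a (n + b n)) \<le> (SUP e\<in>E. ennreal (edge_diff f e))"
proof (cases "(SUP e\<in>E. ennreal (edge_diff f e))")
  case (real G)
  have le: "edge_diff f e \<le> G" if "e \<in> E" for e
  proof -
    have "ennreal (edge_diff f e) \<le> ennreal G"
      using that unfolding real(2)[symmetric] by (rule SUP_upper)
    then show ?thesis using real(1) by simp
  qed
  have "(\<integral>\<^sup>+n. ennreal (a n - a (n + b n) - G) \<partial>count_space {1..})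
      \<le> (\<integral>\<^sup>+e. ennreal (edge_diff f e - G) \<partial>count_space E)"
    unfolding a_def b_def using assms(3-7) real(1) by (intro nn_integral_gap_truncation_le)
  also have "\<dots> = (\<integral>\<^sup>+e. 0 \<partial>count_space E)"
    using le by (intro nn_integral_cong) (simp add: ennreal_neg)
  finally have "(\<integral>\<^sup>+n. ennreal (a n - a (n + b n) - G) \<partial>count_space {1..}) = 0" by simp
  then have "ennreal (a n - a (n + b n) - G) = 0"
    using \<open>n \<ge> 1\<close> by (subst (asm) nn_integral_0_iff_AE) (auto simp: AE_count_space)
  then show ?thesis unfolding real(2) by (intro ennreal_leI) (simp add: ennreal_eq_0_iff)
next
  case top
  then show ?thesis by (simp only: top_greatest)
qed

section \<open>Long gaps as sums of gaps\<close>

text \<open>Change of variables along a map that is at most \<open>m\<close>-to-one. It serves with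
  \<open>m = 1\<close> for injective shifts of indices and with \<open>m = D\<close> for lower
  endpoints of edges.\<close>

lemma nn_integral_count_space_compose_le:
  fixes F :: "'j \<Rightarrow> ennreal" and m :: ennreal
  assumes "countable A" and g: "g ` A \<subseteq> B"
    and fibre: "\<And>y. y \<in> B \<Longrightarrow> emeasure (count_space A) {x \<in> A. g x = y} \<le> m"
  shows "(\<integral>\<^sup>+x. F (g x) \<partial>count_space A) \<le> m * (\<integral>\<^sup>+y. F y \<partial>count_space B)"
proof -
  \<comment> \<open>Writing \<open>F (g x)\<close> as a sum supported at \<open>y = g x\<close> lets
    Tonelli sum over the fibres of \<open>g\<close> first.\<close>
  have "(\<integral>\<^sup>+x. F (g x) \<partial>count_space A)
      = (\<integral>\<^sup>+x. (\<integral>\<^sup>+y. F y * indicator {g x} y \<partial>count_space B) \<partial>count_space A)"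
  proof (rule nn_integral_cong)
    fix x assume "x \<in> space (count_space A)"
    then show "F (g x) = (\<integral>\<^sup>+y. F y * indicator {g x} y \<partial>count_space B)"
      using g by (subst nn_integral_count_space'[of "{g x}"]) auto
  qed
  also have "\<dots> = (\<integral>\<^sup>+y. (\<integral>\<^sup>+x. F y * indicator {g x} y \<partial>count_space A) \<partial>count_space B)"
    using \<open>countable A\<close> by (intro nn_integral_count_space_nn_integral[symmetric]) auto
  also have "\<dots> \<le> (\<integral>\<^sup>+y. m * F y \<partial>count_space B)"
  proof (rule nn_integral_mono)
    fix y assume "y \<in> space (count_space B)"
    then have "y \<in> B" by simp
    have "(\<integral>\<^sup>+x. F y * indicator {g x} y \<partial>count_space A)
        = (\<integral>\<^sup>+x. F y * indicator {x \<in> A. g x = y} x \<partial>count_space A)"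
      by (intro nn_integral_cong) (auto simp: indicator_def)
    also have "\<dots> = F y * emeasure (count_space A) {x \<in> A. g x = y}"
      by (rule nn_integral_cmult_indicator) auto
    also have "\<dots> \<le> m * F y"
      using fibre[OF \<open>y \<in> B\<close>] by (subst mult.commute) (rule mult_right_mono; simp)
    finally show "(\<integral>\<^sup>+x. F y * indicator {g x} y \<partial>count_space A) \<le> m * F y" .
  qed
  also have "\<dots> = m * (\<integral>\<^sup>+y. F y \<partial>count_space B)" by (rule nn_integral_cmult) simp
  finally show ?thesis .
qed

text \<open>Telescoping in steps of the fixed length \<open>b i\<close>. Since \<open>b\<close> is
  nondecreasing, the step from \<open>i + k * b i\<close> is no longer than the value of
  \<open>b\<close> there, and \<open>a\<close> is nonincreasing.\<close>

lemma long_gap_le_sum_gaps: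
  fixes V :: "'a set" and E :: "'a set set" and f :: "'a \<Rightarrow> real"
  defines "a \<equiv> kth_largest V f" and "b \<equiv> min_boundary V E"
  assumes van: "vanishes_at_infinity V f"
    and mono: "\<And>n. n \<ge> 1 \<Longrightarrow> min_boundary V E n \<le> min_boundary V E (n + 1)"
    and "i \<ge> 1"
  shows "a i - a (i + K * b i) \<le> (\<Sum>k<K. a (i + k * b i) - a (i + k * b i + b (i + k * b i)))"
proof -
  have "a i - a (i + K * b i) = (\<Sum>k<K. a (i + k * b i) - a (i + Suc k * b i))"
    using sum_lessThan_telescope'[of "\<lambda>k. a (i + k * b i)" K] by simp
  also have "\<dots> \<le> (\<Sum>k<K. a (i + k * b i) - a (i + k * b i + b (i + k * b i)))"
  proof (rule sum_mono)
    fix k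
    have "b i \<le> b (i + k * b i)"
      unfolding b_def using mono \<open>i \<ge> 1\<close> by (rule min_boundary_mono) simp_all
    then show "a (i + k * b i) - a (i + Suc k * b i)
        \<le> a (i + k * b i) - a (i + k * b i + b (i + k * b i))"
      using kth_largest_antimono[OF van, of "i + Suc k * b i" "i + k * b i + b (i + k * b i)"] \<open>i \<ge> 1\<close>
      by (simp add: a_def)
  qed
  finally show ?thesis .
qed

text \<open>The factor \<open>K powr p\<close> is \<open>K powr (p - 1)\<close> from the power mean
  inequality times \<open>K\<close>, the number of shifted sums, each at most the full power sum of
  \<open>d\<close>.\<close>

lemma nn_integral_long_gap_powr_le:
  fixes V :: "'a set" and E :: "'a set set" and f :: "'a \<Rightarrow> real" and p :: real
  defines "a \<equiv> kth_largest V f" and "b \<equiv> min_boundary V E"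
  assumes van: "vanishes_at_infinity V f"
    and mono: "\<And>n. n \<ge> 1 \<Longrightarrow> min_boundary V E n \<le> min_boundary V E (n + 1)"
    and "p \<ge> 1" and "K \<ge> 1"
  shows "(\<integral>\<^sup>+i. ennreal ((a i - a (i + K * b i)) powr p) \<partial>count_space {1..})
    \<le> ennreal (real K powr p) * (\<integral>\<^sup>+n. ennreal ((a n - a (n + b n)) powr p) \<partial>count_space {1..})"
proof -
  define d where "d n = a n - a (n + b n)" for n
  have anti: "a m \<le> a n" if "1 \<le> n" "n \<le> m" for m n
    unfolding a_def using van that by (rule kth_largest_antimono)
  have d: "d n \<ge> 0" if "n \<ge> 1" for n using anti[of n "n + b n"] that by (simp add: d_def)
  have "(\<integral>\<^sup>+i. ennreal ((a i - a (i + K * b i)) powr p) \<partial>count_space {1..})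
      \<le> (\<integral>\<^sup>+i. (\<Sum>k<K. ennreal (real K powr (p - 1)) * ennreal (d (i + k * b i) powr p)) \<partial>count_space {1..})"
  proof (rule nn_integral_mono)
    fix i :: nat assume "i \<in> space (count_space {1..})"
    then have i: "i \<ge> 1" by simp
    have "(a i - a (i + K * b i)) powr p \<le> (\<Sum>k<K. d (i + k * b i)) powr p"
      using anti[OF i, of "i + K * b i"] long_gap_le_sum_gaps[OF van mono i, where K = K] \<open>p \<ge> 1\<close>
      by (intro powr_mono2) (auto simp: a_def b_def d_def)
    also have "\<dots> \<le> real K powr (p - 1) * (\<Sum>k<K. d (i + k * b i) powr p)"
      using sum_powr_le_power_mean[of "{..<K}" "\<lambda>k. d (i + k * b i)" p] d i \<open>p \<ge> 1\<close> by simp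
    finally have "ennreal ((a i - a (i + K * b i)) powr p)
        \<le> ennreal (\<Sum>k<K. real K powr (p - 1) * d (i + k * b i) powr p)"
      by (intro ennreal_leI) (simp add: sum_distrib_left)
    also have "\<dots> = (\<Sum>k<K. ennreal (real K powr (p - 1)) * ennreal (d (i + k * b i) powr p))"
      by (simp add: sum_ennreal[symmetric] ennreal_mult)
    finally show "ennreal ((a i - a (i + K * b i)) powr p)
        \<le> (\<Sum>k<K. ennreal (real K powr (p - 1)) * ennreal (d (i + k * b i) powr p))" .
  qed
  also have "\<dots> = (\<Sum>k<K. ennreal (real K powr (p - 1)) *
      (\<integral>\<^sup>+i. ennreal (d (i + k * b i) powr p) \<partial>count_space {1..}))"
    by (simp add: nn_integral_sum nn_integral_cmult)
  also have "\<dots> \<le> (\<Sum>k<K. ennreal (real K powr (p - 1)) *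
      (\<integral>\<^sup>+n. ennreal (d n powr p) \<partial>count_space {1..}))"
  proof (intro sum_mono mult_left_mono)
    fix k
    \<comment> \<open>The shift is strictly increasing because \<open>b\<close> is
      nondecreasing.\<close>
    have inj: "inj_on (\<lambda>i. i + k * b i) {1..}"
    proof (rule strict_mono_on_imp_inj_on, rule strict_mono_onI)
      fix i j :: nat assume "i \<in> {1..}" "i < j"
      have "b i \<le> b j"
        unfolding b_def using mono by (rule min_boundary_mono) (use \<open>i \<in> {1..}\<close> \<open>i < j\<close> in auto)
      with \<open>i < j\<close> show "i + k * b i < j + k * b j"
        by (intro add_less_le_mono mult_le_mono2)
    qed
    have "emeasure (count_space {1..}) {i \<in> {1..}. i + k * b i = n} \<le> 1" for n
    proof (cases "{i \<in> {1..}. i + k * b i = n} = {}")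
      case True
      then show ?thesis by (simp del: Collect_empty_eq)
    next
      case False
      then obtain i where "i \<ge> 1" "i + k * b i = n" by auto
      then have "{i \<in> {1..}. i + k * b i = n} \<subseteq> {i}"
        using inj by (auto dest: inj_onD)
      then have "emeasure (count_space {1..}) {i \<in> {1..}. i + k * b i = n}
          \<le> emeasure (count_space {1..}) {i}"
        using \<open>i \<ge> 1\<close> by (intro emeasure_mono) auto
      also have "\<dots> = 1" using \<open>i \<ge> 1\<close> by simp
      finally show ?thesis .
    qed
    then have "(\<integral>\<^sup>+i. ennreal (d (i + k * b i) powr p) \<partial>count_space {1..})
        \<le> 1 * (\<integral>\<^sup>+n. ennreal (d n powr p) \<partial>count_space {1..})"
      by (intro nn_integral_count_space_compose_le) auto
    then show "(\<integral>\<^sup>+i. ennreal (d (i + k * b i) powr p) \<partial>count_space {1..})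
        \<le> (\<integral>\<^sup>+n. ennreal (d n powr p) \<partial>count_space {1..})" by simp
  qed auto
  also have "\<dots> = ennreal (real K) * ennreal (real K powr (p - 1)) *
      (\<integral>\<^sup>+n. ennreal (d n powr p) \<partial>count_space {1..})"
    by (simp add: ennreal_of_nat_eq_real_of_nat mult.assoc)
  also have "ennreal (real K) * ennreal (real K powr (p - 1)) = ennreal (real K powr p)"
    using \<open>K \<ge> 1\<close> by (simp add: ennreal_mult[symmetric] powr_mult_base)
  finally show ?thesis by (simp add: d_def)
qed

section \<open>Edges in the enumeration and the gradient of the rearrangement\<close>

text \<open>With the endpoints ordered by index, the later one is a boundary vertex of the initial
  segment ending at the earlier one, so the hypothesis on the enumeration locates it.\<close>

lemma edge_between_enumerated_vertices:
  fixes V :: "'a set" and E :: "'a set set" and v :: "nat \<Rightarrow> 'a" and c :: real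
  assumes simple: "simple_graph V E" and v: "bij_betw v {1..} V"
    and bd: "\<And>n. n \<ge> 1 \<Longrightarrow> vertex_boundary V E (v ` {1..n})
               \<subseteq> v ` {j. n < j \<and> real j \<le> real n + c * real (min_boundary V E n)}"
    and "c \<le> real K" and "e \<in> E"
  shows "\<exists>i j. 1 \<le> i \<and> i < j \<and> j \<le> i + K * min_boundary V E i \<and> e = {v i, v j}"
proof -
  have inj: "inj_on v {1..}" and surj: "v ` {1..} = V" using v by (auto simp: bij_betw_def)
  obtain x y where xy: "e = {x, y}" "x \<noteq> y" "x \<in> V" "y \<in> V"
    using simple \<open>e \<in> E\<close> unfolding simple_graph_def by (fastforce simp: card_2_iff)
  then obtain k l where "k \<ge> 1" "l \<ge> 1" "x = v k" "y = v l"
    unfolding surj[symmetric] by auto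
  with xy obtain i j where ij: "1 \<le> i" "i < j" "e = {v i, v j}"
    by (metis insert_commute linorder_neqE_nat)
  have "v j \<notin> v ` {1..i}"
    using ij inj by (auto dest!: inj_onD)
  moreover have "v j \<in> V" using ij surj by auto
  ultimately have "v j \<in> vertex_boundary V E (v ` {1..i})"
    using ij \<open>e \<in> E\<close> by (auto simp: vertex_boundary_def)
  then obtain j' where j': "v j = v j'" "i < j'"
      "real j' \<le> real i + c * real (min_boundary V E i)"
    using bd[OF ij(1)] by auto
  have "j = j'" using j' ij inj by (auto dest: inj_onD)
  have "real j \<le> real i + c * real (min_boundary V E i)" using j' \<open>j = j'\<close> by simp
  also have "\<dots> \<le> real i + real K * real (min_boundary V E i)"
    using \<open>c \<le> real K\<close> by (intro add_left_mono mult_right_mono) auto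
  also have "\<dots> = real (i + K * min_boundary V E i)" by simp
  finally have "j \<le> i + K * min_boundary V E i" by (simp only: of_nat_le_iff)
  with ij show ?thesis by blast
qed

text \<open>The constants arise in turn: \<open>D\<close> from grouping edges by lower endpoint,
  \<open>K powr p\<close> from splitting long gaps into gaps, and 1 from comparing gaps with the
  gradient of \<open>f\<close>.\<close>

lemma nn_integral_rearrangement_powr_le:
  fixes V :: "'a set" and E :: "'a set set" and v :: "nat \<Rightarrow> 'a"
    and D c p :: real and f :: "'a \<Rightarrow> real"
  assumes simple: "simple_graph V E" and "countable V"
    and mono: "\<And>n. n \<ge> 1 \<Longrightarrow> min_boundary V E n \<le> min_boundary V E (n + 1)"
    and deg: "degree_le V E D" and v: "bij_betw v {1..} V"
    and bd: "\<And>n. n \<ge> 1 \<Longrightarrow> vertex_boundary V E (v ` {1..n})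
               \<subseteq> v ` {j. n < j \<and> real j \<le> real n + c * real (min_boundary V E n)}"
    and van: "vanishes_at_infinity V f" and "p \<ge> 1" and "K \<ge> 1" and "c \<le> real K"
  shows "(\<integral>\<^sup>+e. ennreal (edge_diff (rearrangement V v f) e powr p) \<partial>count_space E)
    \<le> ennreal (D * real K powr p) * (\<integral>\<^sup>+e. ennreal (edge_diff f e powr p) \<partial>count_space E)"
proof -
  define a where "a = kth_largest V f"
  define b where "b = min_boundary V E"
  have surj: "v ` {1..} = V" using v by (auto simp: bij_betw_def)
  \<comment> \<open>\<open>V\<close> is nonempty, so \<open>D\<close> bounds an actual degree. The
    sign allows \<open>ennreal (D * real K powr p)\<close> to be split into a product.\<close>
  have "D \<ge> 0" using deg surj by (force simp: degree_le_def intro: order_trans[OF of_nat_0_le_iff])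
  have "\<forall>e\<in>E. \<exists>i. 1 \<le> i \<and> (\<exists>j. i < j \<and> j \<le> i + K * b i \<and> e = {v i, v j})"
    unfolding b_def
    using edge_between_enumerated_vertices[OF simple v bd \<open>c \<le> real K\<close>] by blast
  then obtain low where low: "\<And>e. e \<in> E \<Longrightarrow> 1 \<le> low e
      \<and> (\<exists>j. low e < j \<and> j \<le> low e + K * b (low e) \<and> e = {v (low e), v j})"
    by metis
  have diff: "edge_diff (rearrangement V v f) e \<le> a (low e) - a (low e + K * b (low e))"
    if e: "e \<in> E" for e
  proof -
    obtain j where j: "low e < j" "j \<le> low e + K * b (low e)" "e = {v (low e), v j}"
      using low[OF e] by blast
    have l: "1 \<le> low e" using low[OF e] by blast
    have "edge_diff (rearrangement V v f) e = edge_diff (rearrangement V v f) {v (low e), v j}"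
      by (rule arg_cong[OF j(3)])
    also have "\<dots> = \<bar>a (low e) - a j\<bar>"
      using j(1) l v by (simp add: edge_diff_pair rearrangement_enum a_def)
    also have "\<dots> = a (low e) - a j"
      using kth_largest_antimono[OF van l, of j] j(1) by (simp add: a_def)
    also have "\<dots> \<le> a (low e) - a (low e + K * b (low e))"
      using kth_largest_antimono[OF van, of j "low e + K * b (low e)"] j(1,2) l by (simp add: a_def)
    finally show ?thesis .
  qed
  \<comment> \<open>Edges with lower endpoint \<open>v i\<close> all contain \<open>v i\<close>, so
    they number at most its degree.\<close>
  have fibre: "emeasure (count_space E) {e \<in> E. low e = i} \<le> ennreal D" if "i \<in> {1..}" for i
  proof -
    have sub: "{e \<in> E. low e = i} \<subseteq> (\<lambda>w. {v i, w}) ` neighbours E (v i)"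
      using low by (fastforce simp: neighbours_def)
    have "v i \<in> V" using that surj by auto
    then have fin: "finite (neighbours E (v i))" and "real (card (neighbours E (v i))) \<le> D"
      using deg by (auto simp: degree_le_def)
    have "card {e \<in> E. low e = i} \<le> card ((\<lambda>w. {v i, w}) ` neighbours E (v i))"
      using sub fin by (intro card_mono) auto
    also have "\<dots> \<le> card (neighbours E (v i))" using fin by (rule card_image_le)
    finally have "real (card {e \<in> E. low e = i}) \<le> D"
      using \<open>real (card (neighbours E (v i))) \<le> D\<close> by linarith
    moreover have "finite {e \<in> E. low e = i}" using sub fin by (auto intro: finite_subset)
    ultimately show ?thesis
      by (subst emeasure_count_space_finite)
        (auto simp: ennreal_of_nat_eq_real_of_nat intro: ennreal_leI)
  qed
  have "(\<integral>\<^sup>+e. ennreal (edge_diff (rearrangement V v f) e powr p) \<partial>count_space E)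
      \<le> (\<integral>\<^sup>+e. ennreal ((a (low e) - a (low e + K * b (low e))) powr p) \<partial>count_space E)"
    using diff edge_diff_nonneg[OF simple] \<open>p \<ge> 1\<close>
    by (intro nn_integral_mono ennreal_leI powr_mono2) auto
  also have "\<dots> \<le> ennreal D *
      (\<integral>\<^sup>+i. ennreal ((a i - a (i + K * b i)) powr p) \<partial>count_space {1..})"
    using countable_edges[OF simple \<open>countable V\<close>] low fibre
    by (intro nn_integral_count_space_compose_le) auto
  also have "\<dots> \<le> ennreal D * (ennreal (real K powr p) *
      (\<integral>\<^sup>+n. ennreal ((a n - a (n + b n)) powr p) \<partial>count_space {1..}))"
    unfolding a_def b_def
    using van mono \<open>p \<ge> 1\<close> \<open>K \<ge> 1\<close> by (intro mult_left_mono nn_integral_long_gap_powr_le) auto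
  also have "\<dots> \<le> ennreal D * (ennreal (real K powr p) *
      (\<integral>\<^sup>+e. ennreal (edge_diff f e powr p) \<partial>count_space E))"
    unfolding a_def b_def
    using simple \<open>countable V\<close> deg van mono \<open>p \<ge> 1\<close>
    by (intro mult_left_mono nn_integral_gap_powr_le) auto
  also have "\<dots> = ennreal (D * real K powr p) *
      (\<integral>\<^sup>+e. ennreal (edge_diff f e powr p) \<partial>count_space E)"
    using \<open>D \<ge> 0\<close> by (simp add: ennreal_mult mult.assoc)
  finally show ?thesis .
qed

text \<open>Along each edge the change is at most a sum of \<open>K\<close> gaps, each bounded by
  the supremum. No edges are counted, so no factor \<open>D\<close> arises.\<close>

lemma SUP_edge_diff_rearrangement_le:
  fixes V :: "'a set" and E :: "'a set set" and v :: "nat \<Rightarrow> 'a"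
    and D c :: real and f :: "'a \<Rightarrow> real"
  assumes simple: "simple_graph V E" and "countable V"
    and mono: "\<And>n. n \<ge> 1 \<Longrightarrow> min_boundary V E n \<le> min_boundary V E (n + 1)"
    and deg: "degree_le V E D" and v: "bij_betw v {1..} V"
    and bd: "\<And>n. n \<ge> 1 \<Longrightarrow> vertex_boundary V E (v ` {1..n})
               \<subseteq> v ` {j. n < j \<and> real j \<le> real n + c * real (min_boundary V E n)}"
    and van: "vanishes_at_infinity V f" and "c \<le> real K"
  shows "(SUP e\<in>E. ennreal (edge_diff (rearrangement V v f) e))
    \<le> ennreal (real K) * (SUP e\<in>E. ennreal (edge_diff f e))"
proof (rule SUP_least)
  define a where "a = kth_largest V f"
  define b where "b = min_boundary V E"
  fix e assume "e \<in> E"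
  then obtain i j where ij: "1 \<le> i" "i < j" "j \<le> i + K * b i" "e = {v i, v j}"
    using edge_between_enumerated_vertices[OF simple v bd \<open>c \<le> real K\<close>] unfolding b_def by blast
  have "edge_diff (rearrangement V v f) e = a i - a j"
    using ij kth_largest_antimono[OF van, of i j] v
    by (simp add: edge_diff_pair rearrangement_enum a_def)
  also have "\<dots> \<le> a i - a (i + K * b i)"
    using ij kth_largest_antimono[OF van, of j "i + K * b i"] by (simp add: a_def)
  also have "\<dots> \<le> (\<Sum>k<K. a (i + k * b i) - a (i + k * b i + b (i + k * b i)))"
    unfolding a_def b_def using van mono ij(1) by (rule long_gap_le_sum_gaps)
  finally have "ennreal (edge_diff (rearrangement V v f) e)
      \<le> ennreal (\<Sum>k<K. a (i + k * b i) - a (i + k * b i + b (i + k * b i)))"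
    by (rule ennreal_leI)
  also have "\<dots> = (\<Sum>k<K. ennreal (a (i + k * b i) - a (i + k * b i + b (i + k * b i))))"
    using ij(1) unfolding a_def by (intro sum_ennreal[symmetric]) (simp add: kth_largest_antimono[OF van])
  also have "\<dots> \<le> (\<Sum>k<K. (SUP e\<in>E. ennreal (edge_diff f e)))"
    unfolding a_def b_def using simple \<open>countable V\<close> deg van mono ij(1)
    by (intro sum_mono gap_le_SUP_edge_diff) auto
  also have "\<dots> = ennreal (real K) * (SUP e\<in>E. ennreal (edge_diff f e))"
    by (simp add: ennreal_of_nat_eq_real_of_nat)
  finally show "ennreal (edge_diff (rearrangement V v f) e)
    \<le> ennreal (real K) * (SUP e\<in>E. ennreal (edge_diff f e))" .
qed

section \<open>The inequality for gradient norms\<close>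

lemma grad_norm_finite_exponent:
  assumes "simple_graph V E" and "countable V" and "p \<noteq> \<infinity>"
  shows "grad_norm E p g =
    (let S = \<integral>\<^sup>+e. ennreal (edge_diff g e powr enn2real p) \<partial>count_space E
     in if S = \<infinity> then \<infinity> else ennreal (enn2real S powr (1 / enn2real p)))"
  using assms by (simp add: grad_norm_def nn_integral_count_space_eq_infsum countable_edges)

theorem theorem5p3:
  fixes V :: "'a set" and E :: "'a set set" and v :: "nat \<Rightarrow> 'a"
    and D c :: real and f :: "'a \<Rightarrow> real" and p :: ennreal
  assumes "simple_graph V E" and "infinite V" and "countable V" and "connected_graph V E"
    and "\<And>n. n \<ge> 1 \<Longrightarrow>
           min_boundary V E (n + 1) \<ge> min_boundary V E n \<and>
           min_boundary V E n \<ge> min_boundary V E 1"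
    and "min_boundary V E 1 \<ge> 2"
    and "degree_le V E D"
    and "bij_betw v {1..} V"
    and "c > 0"
    and "\<And>n. n \<ge> 1 \<Longrightarrow>
           vertex_boundary V E (v ` {1..n})
             \<subseteq> v ` {j. n < j \<and> real j \<le> real n + c * real (min_boundary V E n)}"
    and "vanishes_at_infinity V f"
    and "1 \<le> p"
  shows "grad_norm E p (rearrangement V v f)
           \<le> ennreal ((c + 1) * (if p = \<infinity> then 1 else D powr (1 / enn2real p))) * grad_norm E p f"
proof -
  have mono: "min_boundary V E n \<le> min_boundary V E (n + 1)" if "n \<ge> 1" for n
    using assms(5)[OF that] by simp
  \<comment> \<open>\<open>K\<close> whole steps of length \<open>b i\<close> cover
    \<open>c * b i\<close>; rounding up costs at most 1, whence the constant
    \<open>c + 1\<close>.\<close>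
  define K where "K = nat \<lceil>c\<rceil>"
  have K: "K \<ge> 1" "c \<le> real K" "real K \<le> c + 1"
    using \<open>c > 0\<close> unfolding K_def by linarith+
  show ?thesis
  proof (cases "p = \<infinity>")
    case True
    have "(SUP e\<in>E. ennreal (edge_diff (rearrangement V v f) e))
        \<le> ennreal (real K) * (SUP e\<in>E. ennreal (edge_diff f e))"
      using assms(1,3) mono assms(7,8,10,11) K(2) by (rule SUP_edge_diff_rearrangement_le)
    also have "\<dots> \<le> ennreal (c + 1) * (SUP e\<in>E. ennreal (edge_diff f e))"
      using K(3) by (intro mult_right_mono ennreal_leI) auto
    finally show ?thesis using True by (simp add: grad_norm_def)
  next
    case False
    define q where "q = enn2real p"
    have q: "q \<ge> 1"
      using \<open>1 \<le> p\<close> False unfolding q_def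
      by (cases p) (auto simp: ennreal_1[symmetric] simp del: ennreal_1)
    define S where "S = (\<integral>\<^sup>+e. ennreal (edge_diff f e powr q) \<partial>count_space E)"
    define S' where
      "S' = (\<integral>\<^sup>+e. ennreal (edge_diff (rearrangement V v f) e powr q) \<partial>count_space E)"
    have le: "S' \<le> ennreal (D * real K powr q) * S"
      unfolding S_def S'_def
      using assms(1,3) mono assms(7,8,10,11) q K(1,2) by (rule nn_integral_rearrangement_powr_le)
    \<comment> \<open>A single vertex has at least two boundary vertices, all of them neighbours.
      Positivity keeps the constant nonzero, which matters for \<open>S = \<infinity>\<close>
      because \<open>0 * \<infinity> = 0\<close> in \<open>ennreal\<close>.\<close>
    have "D > 0"
    proof -
      have v1: "v 1 \<in> V" using \<open>bij_betw v {1..} V\<close> by (auto simp: bij_betw_def)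
      then have "2 \<le> card (vertex_boundary V E {v 1})"
        using min_boundary_le[of "{v 1}" V E] \<open>min_boundary V E 1 \<ge> 2\<close> by simp
      also have "\<dots> \<le> card (neighbours E (v 1))"
        using v1 \<open>degree_le V E D\<close>
        by (intro card_mono) (auto simp: degree_le_def vertex_boundary_def neighbours_def)
      finally show ?thesis using v1 \<open>degree_le V E D\<close> by (force simp: degree_le_def)
    qed
    have norms: "grad_norm E p f = (if S = \<infinity> then \<infinity> else ennreal (enn2real S powr (1 / q)))"
      "grad_norm E p (rearrangement V v f)
        = (if S' = \<infinity> then \<infinity> else ennreal (enn2real S' powr (1 / q)))"
      using grad_norm_finite_exponent[OF assms(1,3) False]
      by (simp_all add: S_def S'_def q_def Let_def)
    show ?thesis
    proof (cases "S = \<infinity>")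
      case True
      then show ?thesis
        using norms \<open>c > 0\<close> \<open>D > 0\<close> False by (simp add: ennreal_mult_top)
    next
      case S: False
      then obtain r where r: "S = ennreal r" "r \<ge> 0" by (cases S) auto
      have le': "S' \<le> ennreal (D * real K powr q * r)"
        using le r \<open>D > 0\<close> by (simp add: ennreal_mult)
      \<comment> \<open>Finiteness passes from \<open>S\<close> to \<open>S'\<close>, so
        \<open>enn2real S'\<close> is the true value and not the default 0 at infinity.\<close>
      then have "S' \<noteq> \<infinity>" by (auto simp: top_unique)
      have "enn2real S' \<le> D * real K powr q * r"
        using le' r \<open>D > 0\<close> by (simp add: enn2real_leI)
      then have "enn2real S' powr (1 / q) \<le> (D * real K powr q * r) powr (1 / q)"
        using q by (intro powr_mono2) auto
      also have "\<dots> = real K * D powr (1 / q) * r powr (1 / q)"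
        using q r \<open>D > 0\<close> by (simp add: powr_mult powr_powr)
      also have "\<dots> \<le> (c + 1) * D powr (1 / q) * r powr (1 / q)"
        using K(3) by (intro mult_right_mono) auto
      finally have "ennreal (enn2real S' powr (1 / q))
          \<le> ennreal ((c + 1) * D powr (1 / q)) * ennreal (r powr (1 / q))"
        using \<open>c > 0\<close> by (simp add: ennreal_mult[symmetric] ennreal_leI)
      then show ?thesis
        using norms S r \<open>S' \<noteq> \<infinity>\<close> False by (simp add: q_def)
    qed
  qed
qed

end
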